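(* Let $X$ be a connected and locally compact topological space homeomorphic to a subspace of a manifold. Let $\Phi$ be a $C^0$ flow on $X$ with a nonempty asymptotically stable compact invariant set $A\subset X$ whose basin of attraction is not equal to $X$. Then $(X,\Phi)$ is not linearizable by an injective $C^0$ map.
   Context: Manifolds are, as usual, finite-dimensional, Hausdorff, second countable and without boundary. $C^0$ means continuous. A flow on $X$ is a group action $\Phi\colon \mathbb{R}\times X\to X$, $(t,x)\mapsto \Phi^t(x)$, of $(\mathbb{R},+)$ on $X$; it is $C^0$ if $\Phi$ is continuous. A set $A\subset X$ is invariant if $\Phi^t(A)=A$ for all $t\in\mathbb{R}$. The basin of attraction of a compact invariant set $A$ is the set of $x\in X$ such that $\Phi^t(x)\to A$ as $t\to\infty$ (i.e. $\Phi^t(x)$ is eventually in every neighborhood of $A$). A compact invariant set $A$ is asymptotically stable if every neighborhood $U$ of $A$ contains a neighborhood $V$ of $A$ with $\Phi^t(V)\subset U$ for all $t\geq 0$, and the basin of attraction of $A$ contains a neighborhood of $A$. A map $F\colon X\to\mathbb{R}^n$ is linearizing (for $\Phi$) if there is a matrix $B\in\mathbb{R}^{n\times n}$ such that $F\circ\Phi^t=e^{Bt}\circ F$ for all $t\in\mathbb{R}$. $(X,\Phi)$ is linearizable by an injective $C^0$ map if for some $n\in\mathbb{N}$ there is a linearizing injective continuous map $F\colon X\to\mathbb{R}^n$. *)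

theory Defs
  imports "HOL-Analysis.Abstract_Euclidean_Space" "HOL-Analysis.Abstract_Topological_Spaces"
    "Jordan_Normal_Form.Matrix"
begin

definition manifold :: "'m topology \<Rightarrow> bool" where
  "manifold M \<longleftrightarrow> Hausdorff_space M \<and> second_countable M \<and>
     (\<exists>n. \<forall>x\<in>topspace M. \<exists>U V. openin M U \<and> x \<in> U \<and> openin (Euclidean_space n) V \<and>
        subtopology M U homeomorphic_space subtopology (Euclidean_space n) V)"

definition flow :: "'a topology \<Rightarrow> (real \<Rightarrow> 'a \<Rightarrow> 'a) \<Rightarrow> bool" where
  "flow X \<Phi> \<longleftrightarrow>
     (\<forall>t. \<forall>x\<in>topspace X. \<Phi> t x \<in> topspace X) \<and>
     (\<forall>x\<in>topspace X. \<Phi> 0 x = x) \<and>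
     (\<forall>s t. \<forall>x\<in>topspace X. \<Phi> (s + t) x = \<Phi> s (\<Phi> t x))"

definition C0_flow :: "'a topology \<Rightarrow> (real \<Rightarrow> 'a \<Rightarrow> 'a) \<Rightarrow> bool" where
  "C0_flow X \<Phi> \<longleftrightarrow> flow X \<Phi> \<and>
     continuous_map (prod_topology euclideanreal X) X (\<lambda>(t, x). \<Phi> t x)"

definition invariant_set :: "'a topology \<Rightarrow> (real \<Rightarrow> 'a \<Rightarrow> 'a) \<Rightarrow> 'a set \<Rightarrow> bool" where
  "invariant_set X \<Phi> A \<longleftrightarrow> A \<subseteq> topspace X \<and> (\<forall>t. \<Phi> t ` A = A)"

text \<open>Neighborhoods are not required to be open.\<close>

definition neighborhood :: "'a topology \<Rightarrow> 'a set \<Rightarrow> 'a set \<Rightarrow> bool" where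
  "neighborhood X A N \<longleftrightarrow> N \<subseteq> topspace X \<and> (\<exists>W. openin X W \<and> A \<subseteq> W \<and> W \<subseteq> N)"

definition basin :: "'a topology \<Rightarrow> (real \<Rightarrow> 'a \<Rightarrow> 'a) \<Rightarrow> 'a set \<Rightarrow> 'a set" where
  "basin X \<Phi> A = {x \<in> topspace X.
     \<forall>N. neighborhood X A N \<longrightarrow> (\<forall>\<^sub>F t in at_top. \<Phi> t x \<in> N)}"

definition asymptotically_stable :: "'a topology \<Rightarrow> (real \<Rightarrow> 'a \<Rightarrow> 'a) \<Rightarrow> 'a set \<Rightarrow> bool" where
  "asymptotically_stable X \<Phi> A \<longleftrightarrow>
     (\<forall>U. neighborhood X A U \<longrightarrow>
        (\<exists>V. neighborhood X A V \<and> V \<subseteq> U \<and> (\<forall>t\<ge>0. \<Phi> t ` V \<subseteq> U))) \<and>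
     (\<exists>N. neighborhood X A N \<and> N \<subseteq> basin X \<Phi> A)"

text \<open>The entrywise exponential series; it converges for every square matrix
  (lemma \<open>summable_mat_exp\<close> below).\<close>

definition mat_exp :: "real mat \<Rightarrow> real mat" where
  "mat_exp A = mat (dim_row A) (dim_row A) (\<lambda>(i, j). \<Sum>k. (A ^\<^sub>m k) $$ (i, j) / fact k)"

lemma summable_mat_exp:
  fixes A :: "real mat"
  assumes A: "A \<in> carrier_mat n n" and ij: "i < n" "j < n"
  shows "summable (\<lambda>k. (A ^\<^sub>m k) $$ (i, j) / fact k)"
proof -
  define c where "c = (\<Sum>i<n. \<Sum>j<n. \<bar>A $$ (i, j)\<bar>)"
  have c: "\<bar>A $$ (i, j)\<bar> \<le> c" if "i < n" "j < n" for i j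
  proof -
    have "\<bar>A $$ (i, j)\<bar> \<le> (\<Sum>j<n. \<bar>A $$ (i, j)\<bar>)"
      by (rule member_le_sum) (use that in auto)
    also have "\<dots> \<le> c"
      unfolding c_def by (rule member_le_sum) (use that in \<open>auto intro: sum_nonneg\<close>)
    finally show ?thesis .
  qed
  have c0: "0 \<le> c" unfolding c_def by (intro sum_nonneg) auto
  have bound: "\<bar>(A ^\<^sub>m k) $$ (i, j)\<bar> \<le> (real n * c) ^ k" if "i < n" "j < n" for i j k
    using that
  proof (induction k arbitrary: i j)
    case 0
    then show ?case using A by auto
  next
    case (Suc k)
    have "\<bar>(A ^\<^sub>m Suc k) $$ (i, j)\<bar> = \<bar>\<Sum>l<n. (A ^\<^sub>m k) $$ (i, l) * A $$ (l, j)\<bar>"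
      using A Suc.prems by (auto simp: scalar_prod_def atLeast0LessThan)
    also have "\<dots> \<le> (\<Sum>l<n. \<bar>(A ^\<^sub>m k) $$ (i, l)\<bar> * \<bar>A $$ (l, j)\<bar>)"
      by (rule order_trans[OF sum_abs]) (simp add: abs_mult)
    also have "\<dots> \<le> (\<Sum>l<n. (real n * c) ^ k * c)"
      using Suc c c0 by (intro sum_mono mult_mono) auto
    finally show ?case by (simp add: mult_ac)
  qed
  show ?thesis
  proof (rule summable_comparison_test')
    show "summable (\<lambda>k. (real n * c) ^ k / fact k)"
      using summable_exp[of "real n * c"] by (simp add: divide_inverse mult.commute)
    show "norm ((A ^\<^sub>m k) $$ (i, j) / fact k) \<le> (real n * c) ^ k / fact k" if "k \<ge> 0" for k
      using bound[OF ij] by (simp add: divide_right_mono)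
  qed
qed

text \<open>A point of \<open>\<real>\<^sup>n\<close> is an element of the topological space \<^term>\<open>Euclidean_space n\<close>,
  a function on \<open>nat\<close> vanishing from index \<open>n\<close> on; \<^term>\<open>vec n\<close> turns it into the column
  vector on which matrices act.\<close>

definition linearizing ::
  "'a topology \<Rightarrow> (real \<Rightarrow> 'a \<Rightarrow> 'a) \<Rightarrow> nat \<Rightarrow> ('a \<Rightarrow> nat \<Rightarrow> real) \<Rightarrow> bool" where
  "linearizing X \<Phi> n F \<longleftrightarrow>
     F ` topspace X \<subseteq> topspace (Euclidean_space n) \<and>
     (\<exists>B \<in> carrier_mat n n. \<forall>t. \<forall>x\<in>topspace X.
        vec n (F (\<Phi> t x)) = mat_exp (t \<cdot>\<^sub>m B) *\<^sub>v vec n (F x))"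

definition linearizable_by_injective_C0 :: "'a topology \<Rightarrow> (real \<Rightarrow> 'a \<Rightarrow> 'a) \<Rightarrow> bool" where
  "linearizable_by_injective_C0 X \<Phi> \<longleftrightarrow>
     (\<exists>n F. linearizing X \<Phi> n F \<and> inj_on F (topspace X) \<and>
        continuous_map X (Euclidean_space n) F)"

end

theory Submission
  imports Defs
begin

text \<open>Suppose a linearizing injective continuous map \<open>F\<close> exists, and let \<open>D\<close> be the basin
  of \<open>A\<close>. Since \<open>D\<close> is nonempty and open and \<open>X\<close> is connected, it suffices to show that \<open>D\<close> is
  closed.

  The vectors with bounded forward orbit under the linear flow form a linear subspace of
  \<open>\<real>\<^sup>n\<close> that contains \<open>F(D)\<close>, because \<open>F(A)\<close> is bounded. On this subspace the linear maps are
  pointwise bounded, hence uniformly bounded because the dimension is finite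
  (\<open>eventually_uniform_seminorm_bound\<close>). So the forward orbits of \<open>F(D)\<close> are equicontinuous
  (\<open>basin_equicontinuous\<close>): if \<open>y\<^sub>0 \<in> D\<close>, then the points \<open>F(\<Phi>\<^sup>t(y))\<close>, for all \<open>y \<in> D\<close> with
  \<open>F(y)\<close> close to \<open>F(y\<^sub>0)\<close>, lie close to \<open>F(A)\<close> from one common time \<open>T\<close> on.

  As \<open>F\<close> is only injective, closeness to \<open>F(A)\<close> in \<open>\<real>\<^sup>n\<close> does not yet mean closeness to \<open>A\<close>.
  Here local compactness enters: choose \<open>A \<subseteq> U \<subseteq> K \<subseteq> D\<close> with \<open>U\<close> open and \<open>K\<close> compact. The compact
  set \<open>F(K - U)\<close> has positive distance from \<open>F(A)\<close> (\<open>injective_image_separation\<close>), so from time \<open>T\<close>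
  on the orbits of the points \<open>y\<close> above avoid \<open>K - U\<close>; as they end up in \<open>U\<close>, connectedness of
  \<open>[T, \<infinity>)\<close> forces them to lie in \<open>K\<close> at time \<open>T\<close> already (\<open>orbit_stays_inside\<close>). If \<open>x\<close> is in the
  closure of \<open>D\<close> and \<open>y\<^sub>0\<close> is close enough to \<open>x\<close>, then \<open>\<Phi>\<^sup>T(x)\<close> is a limit of such points
  \<open>\<Phi>\<^sup>T(y) \<in> K\<close>. Hence \<open>\<Phi>\<^sup>T(x) \<in> K \<subseteq> D\<close>, and so \<open>x \<in> D\<close>.\<close>

section \<open>Uniform boundedness in finite dimension\<close>

definition coord_norm :: "nat \<Rightarrow> (nat \<Rightarrow> real) \<Rightarrow> real" where
  "coord_norm n v = (\<Sum>i<n. \<bar>v i\<bar>)"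

definition coord_dist :: "nat \<Rightarrow> (nat \<Rightarrow> real) \<Rightarrow> (nat \<Rightarrow> real) \<Rightarrow> real" where
  "coord_dist n v w = coord_norm n (\<lambda>i. v i - w i)"

lemma coord_norm_nonneg: "0 \<le> coord_norm n v"
  by (simp add: coord_norm_def sum_nonneg)

lemma coord_norm_add: "coord_norm n (\<lambda>i. v i + w i) \<le> coord_norm n v + coord_norm n w"
  unfolding coord_norm_def sum.distrib[symmetric] by (intro sum_mono abs_triangle_ineq)

lemma coord_norm_scale: "coord_norm n (\<lambda>i. c * v i) = \<bar>c\<bar> * coord_norm n v"
  by (simp add: coord_norm_def abs_mult sum_distrib_left)

lemma coord_dist_commute: "coord_dist n v w = coord_dist n w v"
  by (simp add: coord_dist_def coord_norm_def abs_minus_commute)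

lemma coord_dist_triangle: "coord_dist n u w \<le> coord_dist n u v + coord_dist n v w"
  using coord_norm_add[of n "\<lambda>i. u i - v i" "\<lambda>i. v i - w i"] by (simp add: coord_dist_def)

lemma coord_dist_le_add: "coord_dist n v w \<le> coord_norm n v + coord_norm n w"
  using coord_norm_add[of n v "\<lambda>i. - w i"] by (simp add: coord_dist_def coord_norm_def)

text \<open>A finite-dimensional Banach--Steinhaus theorem. The induction on the dimension splits off
  one eventually bounded vector \<open>w0\<close> with nonzero last coordinate, if there is one: subtracting a
  multiple of \<open>w0\<close> from an eventually bounded vector leaves an eventually bounded vector whose
  last coordinate is zero. The time from which the bound holds does not depend on
  the vector, since only finitely many vectors are split off.\<close>

lemma eventually_uniform_seminorm_bound:
  fixes q :: "'t \<Rightarrow> (nat \<Rightarrow> real) \<Rightarrow> real"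
  assumes add: "\<And>t v w. q t (\<lambda>i. v i + w i) \<le> q t v + q t w"
    and scale: "\<And>t c v. q t (\<lambda>i. c * v i) \<le> \<bar>c\<bar> * q t v"
  shows "\<exists>C\<ge>0. \<forall>\<^sub>F t in G. \<forall>w. (\<forall>i\<ge>n. w i = 0) \<longrightarrow> (\<exists>c. \<forall>\<^sub>F s in G. q s w \<le> c) \<longrightarrow>
           q t w \<le> C * coord_norm n w"
proof (induction n)
  case 0
  have "q t w \<le> 0" if "\<forall>i\<ge>0. w i = 0" for t w
  proof -
    have "w = (\<lambda>i. 0 * w i)" using that by auto
    then show ?thesis using scale[of t 0 w] by simp
  qed
  then show ?case by (intro exI[of _ 0]) auto
next
  case (Suc n)
  then obtain C where C: "C \<ge> 0"
    and IH: "\<forall>\<^sub>F t in G. \<forall>w. (\<forall>i\<ge>n. w i = 0) \<longrightarrow> (\<exists>c. \<forall>\<^sub>F s in G. q s w \<le> c) \<longrightarrow>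
           q t w \<le> C * coord_norm n w" by blast
  have norm_Suc: "coord_norm (Suc n) w = coord_norm n w + \<bar>w n\<bar>" for w
    by (simp add: coord_norm_def)
  show ?case
  proof (cases "\<exists>w0 c0. (\<forall>i\<ge>Suc n. w0 i = 0) \<and> (\<forall>\<^sub>F s in G. q s w0 \<le> c0) \<and> w0 n \<noteq> 0")
    case False
    have zero: "\<forall>i\<ge>n. w i = 0"
      if "\<forall>i\<ge>Suc n. w i = 0" "\<exists>c. \<forall>\<^sub>F s in G. q s w \<le> c" for w
      using that False by (metis le_neq_implies_less Suc_leI)
    show ?thesis
    proof (intro exI[of _ C] conjI C)
      show "\<forall>\<^sub>F t in G. \<forall>w. (\<forall>i\<ge>Suc n. w i = 0) \<longrightarrow> (\<exists>c. \<forall>\<^sub>F s in G. q s w \<le> c) \<longrightarrow>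
           q t w \<le> C * coord_norm (Suc n) w"
        using IH
      proof eventually_elim
        case (elim t)
        show ?case
        proof (intro allI impI)
          fix w
          assume w: "\<forall>i\<ge>Suc n. w i = 0" "\<exists>c. \<forall>\<^sub>F s in G. q s w \<le> c"
          have "q t w \<le> C * coord_norm n w" using elim zero[OF w] w(2) by blast
          then show "q t w \<le> C * coord_norm (Suc n) w"
            using zero[OF w] by (simp add: norm_Suc)
        qed
      qed
    qed
  next
    case True
    then obtain w0 c0 where w0: "\<forall>i\<ge>Suc n. w0 i = 0" "\<forall>\<^sub>F s in G. q s w0 \<le> c0" "w0 n \<noteq> 0"
      by blast
    define m where "m = (C * coord_norm n w0 + \<bar>c0\<bar>) / \<bar>w0 n\<bar>"
    have m0: "0 \<le> m" unfolding m_def using C coord_norm_nonneg[of n w0] by simp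
    show ?thesis
    proof (intro exI[of _ "C + m"] conjI)
      show "0 \<le> C + m" using C m0 by simp
      show "\<forall>\<^sub>F t in G. \<forall>w. (\<forall>i\<ge>Suc n. w i = 0) \<longrightarrow> (\<exists>c. \<forall>\<^sub>F s in G. q s w \<le> c) \<longrightarrow>
           q t w \<le> (C + m) * coord_norm (Suc n) w"
        using IH w0(2)
      proof eventually_elim
        case (elim t)
        show ?case
        proof (intro allI impI)
          fix w
          assume w: "\<forall>i\<ge>Suc n. w i = 0" and "\<exists>c. \<forall>\<^sub>F s in G. q s w \<le> c"
          then obtain c where c: "\<forall>\<^sub>F s in G. q s w \<le> c" by blast
          define a where "a = w n / w0 n"
          define w' where "w' = (\<lambda>i. w i + (- a) * w0 i)"
          have w'0: "\<forall>i\<ge>n. w' i = 0"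
          proof (intro allI impI)
            fix i assume "n \<le> i"
            then consider "i = n" | "i \<ge> Suc n" by linarith
            then show "w' i = 0"
              by cases (use w w0(1,3) in \<open>simp_all add: w'_def a_def\<close>)
          qed
          have "\<forall>\<^sub>F s in G. q s w' \<le> c + \<bar>a\<bar> * c0"
            using c w0(2)
          proof eventually_elim
            case (elim s)
            have "q s w' \<le> q s w + q s (\<lambda>i. (- a) * w0 i)" unfolding w'_def by (rule add)
            also have "\<dots> \<le> c + \<bar>a\<bar> * c0"
              using scale[of s "- a" w0] elim mult_left_mono[OF elim(2), of "\<bar>a\<bar>"] by simp
            finally show ?case .
          qed
          then have qw': "q t w' \<le> C * coord_norm n w'" using elim(1) w'0 by blast
          have "coord_norm n w' \<le> coord_norm n w + \<bar>a\<bar> * coord_norm n w0"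
            unfolding w'_def using coord_norm_add[of n w "\<lambda>i. (- a) * w0 i"]
            by (simp only: coord_norm_scale abs_minus_cancel)
          then have b: "q t w' \<le> C * (coord_norm n w + \<bar>a\<bar> * coord_norm n w0)"
            using qw' mult_left_mono[OF _ C] by (meson order_trans)
          have "q t w \<le> q t w' + q t (\<lambda>i. a * w0 i)"
            using add[of t w' "\<lambda>i. a * w0 i"] by (simp add: w'_def)
          also have "\<dots> \<le> q t w' + \<bar>a\<bar> * \<bar>c0\<bar>"
            using scale[of t a w0] mult_left_mono[of "q t w0" "\<bar>c0\<bar>" "\<bar>a\<bar>"] elim(2)
            by linarith
          also have "\<dots> \<le> C * coord_norm n w + \<bar>a\<bar> * (C * coord_norm n w0 + \<bar>c0\<bar>)"
            using b by (simp add: algebra_simps)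
          also have "\<bar>a\<bar> * (C * coord_norm n w0 + \<bar>c0\<bar>) = m * \<bar>w n\<bar>"
            by (simp add: a_def m_def)
          also have "C * coord_norm n w + m * \<bar>w n\<bar> \<le> (C + m) * coord_norm (Suc n) w"
            using C m0 coord_norm_nonneg[of n w] by (simp add: norm_Suc algebra_simps)
          finally show "q t w \<le> (C + m) * coord_norm (Suc n) w" .
        qed
      qed
    qed
  qed
qed

section \<open>Compact neighborhoods and separation\<close>

lemma compact_neighborhood_inside_open:
  assumes "locally_compact_space X" "Hausdorff_space X"
    and A: "compactin X A" and V: "openin X V" "A \<subseteq> V"
  obtains U K where "openin X U" "compactin X K" "closedin X K" "A \<subseteq> U" "U \<subseteq> K" "K \<subseteq> V"
proof -
  obtain U L where UL: "openin X U" "compactin X L" "closedin X L" "A \<subseteq> U" "U \<subseteq> L"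
    using assms locally_compact_space_compact_closed_compact[of X] by metis
  have "closedin X (L - V)" using UL(3) V(1) by (rule closedin_diff)
  then have "compactin X (L - V)" using UL(2) closed_compactin by blast
  moreover have "disjnt A (L - V)" using V(2) by (auto simp: disjnt_def)
  ultimately obtain P Q where PQ: "openin X P" "openin X Q" "A \<subseteq> P" "L - V \<subseteq> Q" "disjnt P Q"
    using Hausdorff_space_compact_separation[OF assms(2) A] by metis
  have cl: "closedin X (L - Q)" using UL(3) PQ(2) by (rule closedin_diff)
  show thesis
  proof (rule that[of "U \<inter> P" "L - Q"])
    show "openin X (U \<inter> P)" using UL(1) PQ(1) by blast
    show "compactin X (L - Q)" using cl UL(2) closed_compactin by blast
  qed (use cl UL PQ in \<open>auto simp: disjnt_def\<close>)
qed

lemma continuous_map_coord: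
  assumes "continuous_map X (Euclidean_space n) F"
  shows "continuous_map X euclideanreal (\<lambda>x. F x i)"
  using assms unfolding Euclidean_space_def continuous_map_in_subtopology
  by (auto simp: continuous_map_componentwise_UNIV)

lemma continuous_map_coord_norm:
  assumes "continuous_map X (Euclidean_space n) F"
  shows "continuous_map X euclideanreal (\<lambda>x. coord_norm n (F x))"
  unfolding coord_norm_def
  by (intro continuous_map_sum continuous_map_real_abs continuous_map_coord[OF assms]) auto

lemma continuous_map_coord_dist:
  assumes "continuous_map X (Euclidean_space n) F"
  shows "continuous_map X euclideanreal (\<lambda>x. coord_dist n (F x) v)"
  unfolding coord_dist_def coord_norm_def
  by (intro continuous_map_sum continuous_map_real_abs continuous_map_diff
      continuous_map_coord[OF assms]) auto

lemma openin_coord_dist_less: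
  assumes "continuous_map X (Euclidean_space n) F"
  shows "openin X {x \<in> topspace X. coord_dist n (F x) v < e}"
  using openin_continuous_map_preimage[OF continuous_map_coord_dist[OF assms], of "{..<e}" v]
  by simp

lemma compactin_coord_norm_bounded:
  assumes "continuous_map X (Euclidean_space n) F" "compactin X A"
  obtains b where "\<And>a. a \<in> A \<Longrightarrow> coord_norm n (F a) < b"
proof -
  have "compact ((\<lambda>x. coord_norm n (F x)) ` A)"
    using image_compactin[OF assms(2) continuous_map_coord_norm[OF assms(1)]] by simp
  then obtain b where "\<forall>r \<in> (\<lambda>x. coord_norm n (F x)) ` A. \<bar>r\<bar> \<le> b"
    using compact_imp_bounded bounded_real by metis
  then have "coord_norm n (F a) < b + 1" if "a \<in> A" for a using that by fastforce
  then show thesis by (rule that)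
qed

text \<open>The distance between image points is a continuous function on the compact set \<open>C \<times> A\<close>,
  where it has no zero.\<close>

lemma injective_image_separation:
  assumes F: "continuous_map X (Euclidean_space n) F" and inj: "inj_on F (topspace X)"
    and C: "compactin X C" and A: "compactin X A" and "C \<inter> A = {}"
  obtains e where "e > 0" "\<And>z a. z \<in> C \<Longrightarrow> a \<in> A \<Longrightarrow> e \<le> coord_dist n (F z) (F a)"
proof -
  have pos: "0 < coord_dist n (F z) (F a)" if "z \<in> C" "a \<in> A" for z a
  proof (rule ccontr)
    assume "\<not> 0 < coord_dist n (F z) (F a)"
    then have "(\<Sum>i<n. \<bar>F z i - F a i\<bar>) = 0"
      using coord_norm_nonneg[of n "\<lambda>i. F z i - F a i"]
      unfolding coord_dist_def coord_norm_def by linarith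
    then have 1: "F z i = F a i" if "i < n" for i using that by (simp add: sum_nonneg_eq_0_iff)
    have za: "z \<in> topspace X" "a \<in> topspace X"
      using that C A compactin_subset_topspace by blast+
    then have "F z \<in> topspace (Euclidean_space n)" "F a \<in> topspace (Euclidean_space n)"
      using continuous_map_funspace[OF F] by auto
    then have "F z i = F a i" for i
      using 1 by (cases "i < n") (auto simp: topspace_Euclidean_space)
    then have "F z = F a" by auto
    then have "z = a" using inj za by (auto dest: inj_onD)
    then show False using that assms(5) by blast
  qed
  let ?d = "\<lambda>(z, a). coord_dist n (F z) (F a)"
  show thesis
  proof (cases "C \<times> A = {}")
    case True
    then show thesis by (intro that[of 1]) auto
  next
    case False
    have "continuous_map (prod_topology X X) (Euclidean_space n) (F \<circ> fst)"
      "continuous_map (prod_topology X X) (Euclidean_space n) (F \<circ> snd)"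
      using continuous_map_compose[OF _ F] continuous_map_fst continuous_map_snd by blast+
    then have "continuous_map (prod_topology X X) euclideanreal
        (\<lambda>p. \<Sum>i<n. \<bar>(F \<circ> fst) p i - (F \<circ> snd) p i\<bar>)"
      by (intro continuous_map_sum continuous_map_real_abs continuous_map_diff
          continuous_map_coord[where n = n]) (auto simp: o_def)
    then have "continuous_map (prod_topology X X) euclideanreal ?d"
      by (simp add: coord_dist_def coord_norm_def case_prod_unfold)
    moreover have "compactin (prod_topology X X) (C \<times> A)"
      using C A by (simp add: compactin_Times)
    ultimately have "compact (?d ` (C \<times> A))"
      using image_compactin by (metis compactin_euclidean_iff)
    moreover have "?d ` (C \<times> A) \<noteq> {}" using False by blast
    ultimately obtain s where s: "s \<in> ?d ` (C \<times> A)" "\<forall>t \<in> ?d ` (C \<times> A). s \<le> t"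
      using compact_attains_inf by metis
    show thesis
    proof (rule that[of s])
      show "s > 0" using s(1) pos by auto
    qed (use s(2) in auto)
  qed
qed

section \<open>Basins of attraction\<close>

lemma C0_flow_time_map:
  assumes "C0_flow X \<Phi>"
  shows "continuous_map X X (\<Phi> t)"
proof -
  have "continuous_map X X ((\<lambda>(t, x). \<Phi> t x) \<circ> (\<lambda>x. (t, x)))"
    by (rule continuous_map_compose[where X' = "prod_topology euclideanreal X"])
      (use assms in \<open>auto simp: C0_flow_def continuous_map_pairwise o_def\<close>)
  then show ?thesis by (simp add: o_def)
qed

lemma C0_flow_orbit:
  assumes "C0_flow X \<Phi>" "x \<in> topspace X"
  shows "continuous_map euclideanreal X (\<lambda>t. \<Phi> t x)"
proof -
  have "continuous_map euclideanreal X ((\<lambda>(t, x). \<Phi> t x) \<circ> (\<lambda>t. (t, x)))"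
    by (rule continuous_map_compose[where X' = "prod_topology euclideanreal X"])
      (use assms in \<open>auto simp: C0_flow_def continuous_map_pairwise o_def\<close>)
  then show ?thesis by (simp add: o_def)
qed

lemma basin_eventually:
  assumes "x \<in> basin X \<Phi> A" "openin X W" "A \<subseteq> W"
  shows "\<forall>\<^sub>F t in at_top. \<Phi> t x \<in> W"
  using assms openin_subset unfolding basin_def neighborhood_def by blast

lemma basin_backward:
  assumes "flow X \<Phi>" "x \<in> topspace X" "\<Phi> s x \<in> basin X \<Phi> A"
  shows "x \<in> basin X \<Phi> A"
proof -
  have "\<forall>\<^sub>F t in at_top. \<Phi> t x \<in> N" if "neighborhood X A N" for N
  proof -
    have "\<forall>\<^sub>F t in at_top. \<Phi> t (\<Phi> s x) \<in> N"
      using assms(3) that by (auto simp: basin_def)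
    then obtain T where T: "\<And>t. t \<ge> T \<Longrightarrow> \<Phi> t (\<Phi> s x) \<in> N"
      by (auto simp: eventually_at_top_linorder)
    have "\<Phi> t x \<in> N" if "t \<ge> T + s" for t
    proof -
      have "\<Phi> t x = \<Phi> (t - s) (\<Phi> s x)"
        using assms(1,2) unfolding flow_def by (metis diff_add_cancel)
      then show ?thesis using T[of "t - s"] that by simp
    qed
    then show ?thesis by (auto simp: eventually_at_top_linorder)
  qed
  then show ?thesis using assms(2) by (auto simp: basin_def)
qed

lemma openin_basin:
  assumes \<Phi>: "C0_flow X \<Phi>" and W: "openin X W" "A \<subseteq> W" "W \<subseteq> basin X \<Phi> A"
  shows "openin X (basin X \<Phi> A)"
proof -
  have flow: "flow X \<Phi>" using \<Phi> by (simp add: C0_flow_def)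
  have "basin X \<Phi> A = (\<Union>s. {x \<in> topspace X. \<Phi> s x \<in> W})"
  proof (intro subset_antisym subsetI)
    fix x assume x: "x \<in> basin X \<Phi> A"
    then obtain s where "\<Phi> s x \<in> W"
      using basin_eventually[OF x W(1,2)] by (auto simp: eventually_at_top_linorder)
    then show "x \<in> (\<Union>s. {x \<in> topspace X. \<Phi> s x \<in> W})" using x by (auto simp: basin_def)
  next
    fix x assume "x \<in> (\<Union>s. {x \<in> topspace X. \<Phi> s x \<in> W})"
    then show "x \<in> basin X \<Phi> A" using basin_backward[OF flow] W(3) by blast
  qed
  moreover have "openin X {x \<in> topspace X. \<Phi> s x \<in> W}" for s
    using openin_continuous_map_preimage[OF C0_flow_time_map[OF \<Phi>] W(1)] .
  ultimately show ?thesis by auto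
qed

text \<open>The times \<open>t \<ge> T\<close> spent in \<open>K\<close> are the times \<open>t \<ge> T\<close> spent in \<open>U\<close>, so they form a clopen
  subset of \<open>[T, \<infinity>)\<close>.\<close>

lemma orbit_stays_inside:
  assumes \<gamma>: "continuous_map euclideanreal X \<gamma>" and "openin X U" "closedin X K" "U \<subseteq> K"
    and avoid: "\<And>t. t \<ge> T \<Longrightarrow> \<gamma> t \<notin> K - U" and ev: "\<forall>\<^sub>F t in at_top. \<gamma> t \<in> U"
  shows "\<gamma> T \<in> K"
proof (rule ccontr)
  assume out: "\<gamma> T \<notin> K"
  have "open {t. \<gamma> t \<in> U}"
    using openin_continuous_map_preimage[OF \<gamma> assms(2)] by simp
  moreover have "closed {t. \<gamma> t \<in> K}"
    using closedin_continuous_map_preimage[OF \<gamma> assms(3)] by simp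
  then have "open (- {t. \<gamma> t \<in> K})" by (simp add: open_Compl)
  moreover obtain T' where "\<And>t. t \<ge> T' \<Longrightarrow> \<gamma> t \<in> U"
    using ev by (auto simp: eventually_at_top_linorder)
  then have "max T T' \<in> {t. \<gamma> t \<in> U} \<inter> {T..}" by simp
  then have "{t. \<gamma> t \<in> U} \<inter> {T..} \<noteq> {}" by blast
  moreover have "- {t. \<gamma> t \<in> K} \<inter> {T..} \<noteq> {}" using out by auto
  moreover have "{T..} \<subseteq> {t. \<gamma> t \<in> U} \<union> - {t. \<gamma> t \<in> K}" using avoid by auto
  moreover have "{t. \<gamma> t \<in> U} \<inter> - {t. \<gamma> t \<in> K} \<inter> {T..} = {}" using assms(4) by auto
  ultimately show False
    using connectedD[of "{T..}" "{t. \<gamma> t \<in> U}" "- {t. \<gamma> t \<in> K}"] connected_Ici by metis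
qed

section \<open>Flows that are linear in injective coordinates\<close>

lemma linearizing_coordinates:
  assumes "linearizing X \<Phi> n F"
  obtains E where "\<forall>t. \<forall>x \<in> topspace X. \<forall>i<n. F (\<Phi> t x) i = (\<Sum>j<n. E t i j * F x j)"
proof -
  obtain B where B: "B \<in> carrier_mat n n"
    and eq: "\<And>t x. x \<in> topspace X \<Longrightarrow>
      vec n (F (\<Phi> t x)) = mat_exp (t \<cdot>\<^sub>m B) *\<^sub>v vec n (F x)"
    using assms by (auto simp: linearizing_def)
  show thesis
  proof (rule that[of "\<lambda>t i j. mat_exp (t \<cdot>\<^sub>m B) $$ (i, j)"], intro allI ballI impI)
    fix t x i
    assume x: "x \<in> topspace X" and i: "i < n"
    have "mat_exp (t \<cdot>\<^sub>m B) \<in> carrier_mat n n" using B by (simp add: mat_exp_def)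
    then have "(mat_exp (t \<cdot>\<^sub>m B) *\<^sub>v vec n (F x)) $ i
        = (\<Sum>j<n. mat_exp (t \<cdot>\<^sub>m B) $$ (i, j) * F x j)"
      using i by (auto simp: scalar_prod_def atLeast0LessThan)
    then show "F (\<Phi> t x) i = (\<Sum>j<n. mat_exp (t \<cdot>\<^sub>m B) $$ (i, j) * F x j)"
      using arg_cong[OF eq[OF x, of t], of "\<lambda>v. v $ i"] i by simp
  qed
qed

text \<open>Orbits of basin points are eventually bounded in the coordinates \<open>F\<close> because they approach
  the compact set \<open>A\<close>. So the differences of two of them are governed by a uniform bound on the
  subspace of vectors with eventually bounded orbit.\<close>

lemma basin_equicontinuous:
  assumes F: "continuous_map X (Euclidean_space n) F" and A: "compactin X A"
    and lin: "\<forall>t. \<forall>x \<in> topspace X. \<forall>i<n. F (\<Phi> t x) i = (\<Sum>j<n. E t i j * F x j)"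
  obtains C where "C \<ge> 0"
    "\<forall>\<^sub>F t in at_top. \<forall>y \<in> basin X \<Phi> A. \<forall>z \<in> basin X \<Phi> A.
       coord_dist n (F (\<Phi> t y)) (F (\<Phi> t z)) \<le> C * coord_dist n (F y) (F z)"
proof -
  define q where "q = (\<lambda>t w. coord_norm n (\<lambda>i. \<Sum>j<n. E t i j * w j))"
  have q_add: "q t (\<lambda>i. v i + w i) \<le> q t v + q t w" for t v w
    unfolding q_def distrib_left sum.distrib by (rule coord_norm_add)
  have q_scale: "q t (\<lambda>i. c * v i) \<le> \<bar>c\<bar> * q t v" for t c v
    unfolding q_def coord_norm_scale[symmetric] by (simp add: sum_distrib_left mult_ac)
  obtain C where C: "C \<ge> 0" and bound: "\<forall>\<^sub>F t in at_top. \<forall>w. (\<forall>i\<ge>n. w i = 0) \<longrightarrow>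
      (\<exists>c. \<forall>\<^sub>F s in at_top. q s w \<le> c) \<longrightarrow> q t w \<le> C * coord_norm n w"
    using eventually_uniform_seminorm_bound[where q = q and G = at_top and n = n, OF q_add q_scale]
    by blast
  have q_diff: "q t (\<lambda>i. F y i - F z i) = coord_dist n (F (\<Phi> t y)) (F (\<Phi> t z))"
    if "y \<in> topspace X" "z \<in> topspace X" for t y z
    unfolding q_def coord_dist_def coord_norm_def
    by (intro sum.cong refl)
      (simp add: lin that right_diff_distrib sum_subtractf)
  obtain b where b: "\<And>a. a \<in> A \<Longrightarrow> coord_norm n (F a) < b"
    using compactin_coord_norm_bounded[OF F A] by blast
  have "openin X {x \<in> topspace X. coord_norm n (F x) < b}"
    using openin_continuous_map_preimage[OF continuous_map_coord_norm[OF F], of "{..<b}"] by simp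
  moreover have "A \<subseteq> {x \<in> topspace X. coord_norm n (F x) < b}"
    using b compactin_subset_topspace[OF A] by blast
  ultimately have ev: "\<forall>\<^sub>F t in at_top. coord_norm n (F (\<Phi> t y)) < b"
    if "y \<in> basin X \<Phi> A" for y
    by (rule eventually_mono[OF basin_eventually[OF that]]) simp
  show thesis
  proof (rule that[OF C])
    show "\<forall>\<^sub>F t in at_top. \<forall>y \<in> basin X \<Phi> A. \<forall>z \<in> basin X \<Phi> A.
       coord_dist n (F (\<Phi> t y)) (F (\<Phi> t z)) \<le> C * coord_dist n (F y) (F z)"
      using bound
    proof (eventually_elim, intro ballI)
      fix t y z
      assume bt: "\<forall>w. (\<forall>i\<ge>n. w i = 0) \<longrightarrow>
          (\<exists>c. \<forall>\<^sub>F s in at_top. q s w \<le> c) \<longrightarrow> q t w \<le> C * coord_norm n w"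
        and y: "y \<in> basin X \<Phi> A" and z: "z \<in> basin X \<Phi> A"
      have yz: "y \<in> topspace X" "z \<in> topspace X" using y z by (auto simp: basin_def)
      have "F y \<in> topspace (Euclidean_space n)" "F z \<in> topspace (Euclidean_space n)"
        using continuous_map_funspace[OF F] yz by auto
      then have "\<forall>i\<ge>n. F y i - F z i = 0" by (auto simp: topspace_Euclidean_space)
      moreover have "\<forall>\<^sub>F s in at_top. q s (\<lambda>i. F y i - F z i) \<le> b + b"
        using ev[OF y] ev[OF z]
      proof eventually_elim
        case (elim s)
        then show ?case
          using coord_dist_le_add[of n "F (\<Phi> s y)" "F (\<Phi> s z)"] by (simp add: q_diff yz)
      qed
      ultimately have "q t (\<lambda>i. F y i - F z i) \<le> C * coord_norm n (\<lambda>i. F y i - F z i)"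
        using bt[rule_format, of "\<lambda>i. F y i - F z i"] by blast
      then show "coord_dist n (F (\<Phi> t y)) (F (\<Phi> t z)) \<le> C * coord_dist n (F y) (F z)"
        by (simp add: q_diff yz coord_dist_def)
    qed
  qed
qed

lemma closedin_basin:
  assumes lc: "locally_compact_space X" and T2: "Hausdorff_space X"
    and \<Phi>: "C0_flow X \<Phi>" and A: "compactin X A"
    and W: "openin X W" "A \<subseteq> W" "W \<subseteq> basin X \<Phi> A"
    and F: "continuous_map X (Euclidean_space n) F" and inj: "inj_on F (topspace X)"
    and lin: "\<forall>t. \<forall>x \<in> topspace X. \<forall>i<n. F (\<Phi> t x) i = (\<Sum>j<n. E t i j * F x j)"
  shows "closedin X (basin X \<Phi> A)"
proof -
  let ?D = "basin X \<Phi> A"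
  have flow: "flow X \<Phi>" using \<Phi> by (simp add: C0_flow_def)
  have DX: "?D \<subseteq> topspace X" by (auto simp: basin_def)
  obtain U K where U: "openin X U" "A \<subseteq> U" "U \<subseteq> K"
    and K: "compactin X K" "closedin X K" "K \<subseteq> W"
    using compact_neighborhood_inside_open[OF lc T2 A W(1,2)] by metis
  have "compactin X (K - U)"
    using closed_compactin[OF K(1) _ closedin_diff[OF K(2) U(1)]] by blast
  moreover have "(K - U) \<inter> A = {}" using U(2) by blast
  ultimately obtain e where e: "e > 0"
    and sep: "\<And>z a. z \<in> K - U \<Longrightarrow> a \<in> A \<Longrightarrow> e \<le> coord_dist n (F z) (F a)"
    using injective_image_separation[OF F inj _ A] by metis
  obtain C where C: "C \<ge> 0"
    and equi: "\<forall>\<^sub>F t in at_top. \<forall>y \<in> ?D. \<forall>z \<in> ?D.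
       coord_dist n (F (\<Phi> t y)) (F (\<Phi> t z)) \<le> C * coord_dist n (F y) (F z)"
    using basin_equicontinuous[OF F A lin] by blast
  have "x \<in> ?D" if x: "x \<in> X closure_of ?D" for x
  proof -
    have xX: "x \<in> topspace X" using x by (simp add: in_closure_of)
    \<comment> \<open>Two points of the ball \<open>Q\<close> have distance at most \<open>2 * r\<close>, and \<open>C * (2 * r) < e / 2\<close>; adding
      one to \<open>C\<close> makes \<open>r\<close> well defined and the inequality strict.\<close>
    define r where "r = e / (4 * (C + 1))"
    have r: "r > 0" "C * (2 * r) < e / 2" using e C by (auto simp: r_def field_simps)
    define Q where "Q = {y \<in> topspace X. coord_dist n (F y) (F x) < r}"
    have Qo: "openin X Q" unfolding Q_def by (rule openin_coord_dist_less[OF F])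
    have xQ: "x \<in> Q" using xX r(1) by (simp add: Q_def coord_dist_def coord_norm_def)
    obtain y0 where y0: "y0 \<in> ?D" "y0 \<in> Q" using x xQ Qo by (auto simp: in_closure_of)
    define P where "P = (\<Union>a\<in>A. {z \<in> topspace X. coord_dist n (F z) (F a) < e / 2})"
    have "openin X P" unfolding P_def using openin_coord_dist_less[OF F] by blast
    moreover have "A \<subseteq> P"
    proof
      fix a assume "a \<in> A"
      moreover have "coord_dist n (F a) (F a) = 0" by (simp add: coord_dist_def coord_norm_def)
      ultimately show "a \<in> P"
        using compactin_subset_topspace[OF A] e unfolding P_def by (intro UN_I[of a]) auto
    qed
    ultimately have "\<forall>\<^sub>F t in at_top. \<Phi> t y0 \<in> P" by (rule basin_eventually[OF y0(1)])
    then obtain T where T: "\<And>t. t \<ge> T \<Longrightarrow> \<Phi> t y0 \<in> P"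
      "\<And>t y z. t \<ge> T \<Longrightarrow> y \<in> ?D \<Longrightarrow> z \<in> ?D \<Longrightarrow>
        coord_dist n (F (\<Phi> t y)) (F (\<Phi> t z)) \<le> C * coord_dist n (F y) (F z)"
      using eventually_conj[OF _ equi] unfolding eventually_at_top_linorder by metis
    have in_K: "\<Phi> T y \<in> K" if y: "y \<in> ?D" "y \<in> Q" for y
    proof (rule orbit_stays_inside[OF _ U(1) K(2) U(3)])
      show "continuous_map euclideanreal X (\<lambda>t. \<Phi> t y)"
        using C0_flow_orbit[OF \<Phi>] y(1) DX by blast
      show "\<forall>\<^sub>F t in at_top. \<Phi> t y \<in> U" by (rule basin_eventually[OF y(1) U(1,2)])
      fix t assume t: "T \<le> t"
      obtain a where a: "a \<in> A" "coord_dist n (F (\<Phi> t y0)) (F a) < e / 2"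
        using T(1)[OF t] by (auto simp: P_def)
      have "coord_dist n (F y) (F y0) \<le> 2 * r"
        using coord_dist_triangle[of n "F y" "F y0" "F x"] y(2) y0(2)
        by (auto simp: Q_def coord_dist_commute[of n "F x"])
      then have "coord_dist n (F (\<Phi> t y)) (F (\<Phi> t y0)) \<le> C * (2 * r)"
        using T(2)[OF t y(1) y0(1)] mult_left_mono[OF _ C] by (meson order_trans)
      then have "coord_dist n (F (\<Phi> t y)) (F a) < e"
        using coord_dist_triangle[of n "F (\<Phi> t y)" "F a" "F (\<Phi> t y0)"] a(2) r(2) by simp
      then show "\<Phi> t y \<notin> K - U" using sep a(1) by force
    qed
    have "\<Phi> T x \<in> K"
    proof (rule ccontr)
      assume out: "\<Phi> T x \<notin> K"
      define O' where "O' = Q \<inter> {y \<in> topspace X. \<Phi> T y \<in> topspace X - K}"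
      have "openin X O'"
        unfolding O'_def
        using openin_continuous_map_preimage[OF C0_flow_time_map[OF \<Phi>]] K(2) Qo by blast
      moreover have "x \<in> O'" using xQ xX out flow by (auto simp: O'_def flow_def)
      ultimately obtain y where "y \<in> ?D" "y \<in> O'" using x by (auto simp: in_closure_of)
      then show False using in_K by (auto simp: O'_def)
    qed
    then show "x \<in> ?D" using basin_backward[OF flow xX] K(3) W(3) by blast
  qed
  then have "X closure_of ?D \<subseteq> ?D" by blast
  then show ?thesis using DX by (simp add: closure_of_subset_eq[symmetric])
qed

theorem corollary6:
  fixes X :: "'a topology" and M :: "'m topology" and S :: "'m set"
    and \<Phi> :: "real \<Rightarrow> 'a \<Rightarrow> 'a" and A :: "'a set"
  assumes "connected_space X" and "locally_compact_space X"
    and "manifold M" and "S \<subseteq> topspace M" and "X homeomorphic_space subtopology M S"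
    and "C0_flow X \<Phi>"
    and "A \<noteq> {}" and "compactin X A" and "invariant_set X \<Phi> A"
    and "asymptotically_stable X \<Phi> A"
    and "basin X \<Phi> A \<noteq> topspace X"
  shows "\<not> linearizable_by_injective_C0 X \<Phi>"
proof
  assume "linearizable_by_injective_C0 X \<Phi>"
  then obtain n F where F: "linearizing X \<Phi> n F" "inj_on F (topspace X)"
    "continuous_map X (Euclidean_space n) F"
    by (auto simp: linearizable_by_injective_C0_def)
  obtain E where lin: "\<forall>t. \<forall>x \<in> topspace X. \<forall>i<n. F (\<Phi> t x) i = (\<Sum>j<n. E t i j * F x j)"
    using linearizing_coordinates[OF F(1)] by blast
  have T2: "Hausdorff_space X"
    using assms(3,5) homeomorphic_Hausdorff_space Hausdorff_space_subtopology
    unfolding manifold_def by blast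
  obtain W where W: "openin X W" "A \<subseteq> W" "W \<subseteq> basin X \<Phi> A"
    using assms(10) unfolding asymptotically_stable_def neighborhood_def
    by (meson subset_trans)
  have "openin X (basin X \<Phi> A)" using openin_basin[OF assms(6) W] .
  moreover have "closedin X (basin X \<Phi> A)"
    using closedin_basin[OF assms(2) T2 assms(6,8) W F(3,2) lin] .
  ultimately have "basin X \<Phi> A = {}"
    using assms(1,11) by (auto simp: connected_space_clopen_in)
  then show False using W assms(7) by blast
qed

end
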